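(* Let $\alpha$ be a hybrid program in $\Delta$-disturbance normal form $\alpha\equiv\mathrm{ctrl}(x);\ \tilde u:=*;\ ?(u-\Delta\le\tilde u\le u+\Delta);\ \mathrm{plant}(\tilde u)$, and let $J$ be an inductive invariant of $\alpha$ (so in particular $J\rightarrow[\alpha]J$ is valid) with $\tilde u\notin\mathrm{FV}(J)$. Let $\omega,\nu$ be states that agree on all variables not in $\mathrm{BV}(\alpha)$, and assume $\omega\models J$. If $(\omega,\nu)\models\langle\alpha\rangle\exists\tilde u^+\,\Upsilon^+$, then $\nu\models J$.
   Context: Differential dynamic logic (dL): states are maps $\omega$ from a set of real-valued variables to $\mathbb{R}$. Hybrid programs are built from assignments $x:=\theta$, nondeterministic assignments $x:=*$ (any real value), tests $?F$ (continue only if $F$ holds, otherwise abort), differential equations $\{x'=\theta\ \&\ Q\}$ (evolve along the ODE for any nonnegative duration while staying in $Q$), sequential composition $;$, nondeterministic choice $\cup$ and repetition $^*$; each program $\alpha$ denotes a transition relation $[\![\alpha]\!]$ on states. dL formulas extend first-order real arithmetic with $[\alpha]\phi$ (true in $\omega$ iff $\phi$ holds in all $\nu$ with $(\omega,\nu)\in[\![\alpha]\!]$) and $\langle\alpha\rangle\phi$ (true iff $\phi$ holds in some such $\nu$); valid means true in all states. $\mathrm{BV}(\alpha)$ are the bound variables of a program, $\mathrm{FV}(\phi)$ the free variables of a formula. A formula $J$ is an inductive invariant of $\alpha$ if $A\rightarrow J$, $J\rightarrow[\alpha]J$, $J\rightarrow S$ are valid (for the safety formula $A\rightarrow[\alpha^*]S$).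 Here $\mathrm{ctrl}(x)$ is a controller program producing control choice $u$, $\tilde u$ is the actual (disturbed) actuator effect, and $\mathrm{plant}(\tilde u)$ is a differential equation driven by $\tilde u$; $\Delta\ge 0$. For every variable $x$ there is a fresh variable $x^+$; $\Upsilon^+$ abbreviates the conjunction of $x^+=x$ over all $x\in\mathrm{BV}(\alpha)$. Transition satisfaction: $(\omega,\nu)\models\phi$ iff $\phi$ is true in the state that agrees with $\omega$ except that each $x^+$ has value $\nu(x)$. *)

theory Defs
  imports Complex_Main
begin

section \<open>Syntax of differential dynamic logic\<close>

text \<open>
  The syntax is parametric in the type of variables. Terms are real polynomials. The
  differential equation system \<open>ODE [(x\<^sub>1, \<theta>\<^sub>1), \<dots>] Q\<close> is \<open>{x\<^sub>1' = \<theta>\<^sub>1, \<dots> & Q}\<close>.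
  The automatically generated functions \<open>vars_trm\<close>, \<open>vars_fml\<close>, \<open>vars_hp\<close> yield all
  variables that occur, free or bound.
\<close>

datatype (vars_trm: 'a) trm =
    Var 'a
  | Const real
  | Neg "'a trm"
  | Plus "'a trm" "'a trm"
  | Minus "'a trm" "'a trm"
  | Times "'a trm" "'a trm"

datatype (vars_fml: 'a) fml =
    TT
  | Eq "'a trm" "'a trm"
  | Le "'a trm" "'a trm"
  | Lt "'a trm" "'a trm"
  | Not "'a fml"
  | And "'a fml" "'a fml"
  | Or "'a fml" "'a fml"
  | Imp "'a fml" "'a fml"
  | Iff "'a fml" "'a fml"
  | All 'a "'a fml"
  | Ex 'a "'a fml"
  | Box "'a hp" "'a fml"
  | Dia "'a hp" "'a fml"
and (vars_hp: 'a) hp =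
    Assign 'a "'a trm"
  | AssignAny 'a
  | Test "'a fml"
  | ODE "('a \<times> 'a trm) list" "'a fml"
  | Seq "'a hp" "'a hp"
  | Choice "'a hp" "'a hp"
  | Loop "'a hp"

section \<open>Semantics\<close>

type_synonym 'a state = "'a \<Rightarrow> real"

primrec trm_val :: "'a trm \<Rightarrow> 'a state \<Rightarrow> real" where
  "trm_val (Var x) \<omega> = \<omega> x"
| "trm_val (Const c) \<omega> = c"
| "trm_val (Neg \<theta>) \<omega> = - trm_val \<theta> \<omega>"
| "trm_val (Plus \<theta> \<eta>) \<omega> = trm_val \<theta> \<omega> + trm_val \<eta> \<omega>"
| "trm_val (Minus \<theta> \<eta>) \<omega> = trm_val \<theta> \<omega> - trm_val \<eta> \<omega>"
| "trm_val (Times \<theta> \<eta>) \<omega> = trm_val \<theta> \<omega> * trm_val \<eta> \<omega>"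

text \<open>
  \<open>ode_flow eqs Q r \<phi>\<close>: on \<open>{0..r}\<close>, \<open>\<phi>\<close> solves the system, stays in \<open>Q\<close>, and keeps every
  variable without an equation constant. At the end points the derivatives are one-sided; for
  \<open>r = 0\<close> the derivative condition is void, so only \<open>Q\<close> is required.
\<close>

definition ode_flow ::
    "('a \<times> 'a trm) list \<Rightarrow> 'a state set \<Rightarrow> real \<Rightarrow> (real \<Rightarrow> 'a state) \<Rightarrow> bool" where
  "ode_flow eqs Q r \<phi> \<longleftrightarrow>
     (\<forall>t\<in>{0..r}.
        \<phi> t \<in> Q \<and>
        (\<forall>(x, \<theta>)\<in>set eqs.
           ((\<lambda>s. \<phi> s x) has_real_derivative trm_val \<theta> (\<phi> t)) (at t within {0..r})) \<and>
        (\<forall>y. y \<notin> fst ` set eqs \<longrightarrow> \<phi> t y = \<phi> 0 y))"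

primrec fml_sem :: "'a fml \<Rightarrow> 'a state set"
  and hp_sem :: "'a hp \<Rightarrow> ('a state \<times> 'a state) set" where
  "fml_sem TT = UNIV"
| "fml_sem (Eq \<theta> \<eta>) = {\<omega>. trm_val \<theta> \<omega> = trm_val \<eta> \<omega>}"
| "fml_sem (Le \<theta> \<eta>) = {\<omega>. trm_val \<theta> \<omega> \<le> trm_val \<eta> \<omega>}"
| "fml_sem (Lt \<theta> \<eta>) = {\<omega>. trm_val \<theta> \<omega> < trm_val \<eta> \<omega>}"
| "fml_sem (Not F) = {\<omega>. \<omega> \<notin> fml_sem F}"
| "fml_sem (And F G) = {\<omega>. \<omega> \<in> fml_sem F \<and> \<omega> \<in> fml_sem G}"
| "fml_sem (Or F G) = {\<omega>. \<omega> \<in> fml_sem F \<or> \<omega> \<in> fml_sem G}"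
| "fml_sem (Imp F G) = {\<omega>. \<omega> \<in> fml_sem F \<longrightarrow> \<omega> \<in> fml_sem G}"
| "fml_sem (Iff F G) = {\<omega>. \<omega> \<in> fml_sem F \<longleftrightarrow> \<omega> \<in> fml_sem G}"
| "fml_sem (All x F) = {\<omega>. \<forall>d. \<omega>(x := d) \<in> fml_sem F}"
| "fml_sem (Ex x F) = {\<omega>. \<exists>d. \<omega>(x := d) \<in> fml_sem F}"
| "fml_sem (Box \<alpha> F) = {\<omega>. \<forall>\<nu>. (\<omega>, \<nu>) \<in> hp_sem \<alpha> \<longrightarrow> \<nu> \<in> fml_sem F}"
| "fml_sem (Dia \<alpha> F) = {\<omega>. \<exists>\<nu>. (\<omega>, \<nu>) \<in> hp_sem \<alpha> \<and> \<nu> \<in> fml_sem F}"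
| "hp_sem (Assign x \<theta>) = {(\<omega>, \<nu>). \<nu> = \<omega>(x := trm_val \<theta> \<omega>)}"
| "hp_sem (AssignAny x) = {(\<omega>, \<nu>). \<exists>d. \<nu> = \<omega>(x := d)}"
| "hp_sem (Test F) = {(\<omega>, \<nu>). \<nu> = \<omega> \<and> \<omega> \<in> fml_sem F}"
| "hp_sem (ODE eqs Q) =
     {(\<omega>, \<nu>). \<exists>r\<ge>0. \<exists>\<phi>. \<phi> 0 = \<omega> \<and> \<phi> r = \<nu> \<and> ode_flow eqs (fml_sem Q) r \<phi>}"
| "hp_sem (Seq \<alpha> \<beta>) = hp_sem \<alpha> O hp_sem \<beta>"
| "hp_sem (Choice \<alpha> \<beta>) = hp_sem \<alpha> \<union> hp_sem \<beta>"
| "hp_sem (Loop \<alpha>) = (hp_sem \<alpha>)\<^sup>*"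

abbreviation sat :: "'a state \<Rightarrow> 'a fml \<Rightarrow> bool" (infix "\<Turnstile>" 50) where
  "\<omega> \<Turnstile> F \<equiv> \<omega> \<in> fml_sem F"

definition valid :: "'a fml \<Rightarrow> bool" where
  "valid F \<longleftrightarrow> (\<forall>\<omega>. \<omega> \<Turnstile> F)"

section \<open>Static semantics\<close>

primrec BV :: "'a hp \<Rightarrow> 'a set" where
  "BV (Assign x \<theta>) = {x}"
| "BV (AssignAny x) = {x}"
| "BV (Test F) = {}"
| "BV (ODE eqs Q) = fst ` set eqs"
| "BV (Seq \<alpha> \<beta>) = BV \<alpha> \<union> BV \<beta>"
| "BV (Choice \<alpha> \<beta>) = BV \<alpha> \<union> BV \<beta>"
| "BV (Loop \<alpha>) = BV \<alpha>"

text \<open>Must-bound variables: those written on every run of the program.\<close>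

primrec MBV :: "'a hp \<Rightarrow> 'a set" where
  "MBV (Assign x \<theta>) = {x}"
| "MBV (AssignAny x) = {x}"
| "MBV (Test F) = {}"
| "MBV (ODE eqs Q) = fst ` set eqs"
| "MBV (Seq \<alpha> \<beta>) = MBV \<alpha> \<union> MBV \<beta>"
| "MBV (Choice \<alpha> \<beta>) = MBV \<alpha> \<inter> MBV \<beta>"
| "MBV (Loop \<alpha>) = {}"

primrec FV :: "'a fml \<Rightarrow> 'a set"
  and FV_hp :: "'a hp \<Rightarrow> 'a set" where
  "FV TT = {}"
| "FV (Eq \<theta> \<eta>) = vars_trm \<theta> \<union> vars_trm \<eta>"
| "FV (Le \<theta> \<eta>) = vars_trm \<theta> \<union> vars_trm \<eta>"
| "FV (Lt \<theta> \<eta>) = vars_trm \<theta> \<union> vars_trm \<eta>"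
| "FV (Not F) = FV F"
| "FV (And F G) = FV F \<union> FV G"
| "FV (Or F G) = FV F \<union> FV G"
| "FV (Imp F G) = FV F \<union> FV G"
| "FV (Iff F G) = FV F \<union> FV G"
| "FV (All x F) = FV F - {x}"
| "FV (Ex x F) = FV F - {x}"
| "FV (Box \<alpha> F) = FV_hp \<alpha> \<union> (FV F - MBV \<alpha>)"
| "FV (Dia \<alpha> F) = FV_hp \<alpha> \<union> (FV F - MBV \<alpha>)"
| "FV_hp (Assign x \<theta>) = vars_trm \<theta>"
| "FV_hp (AssignAny x) = {}"
| "FV_hp (Test F) = FV F"
| "FV_hp (ODE eqs Q) = fst ` set eqs \<union> (\<Union>(x, \<theta>)\<in>set eqs. vars_trm \<theta>) \<union> FV Q"
| "FV_hp (Seq \<alpha> \<beta>) = FV_hp \<alpha> \<union> (FV_hp \<beta> - MBV \<alpha>)"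
| "FV_hp (Choice \<alpha> \<beta>) = FV_hp \<alpha> \<union> FV_hp \<beta>"
| "FV_hp (Loop \<alpha>) = FV_hp \<alpha>"

lemma finite_BV: "finite (BV \<alpha>)"
  by (induction \<alpha>) auto

section \<open>Inductive invariants and monitors\<close>

definition inductive_invariant :: "'a fml \<Rightarrow> 'a hp \<Rightarrow> 'a fml \<Rightarrow> 'a fml \<Rightarrow> bool" where
  "inductive_invariant A \<alpha> S J \<longleftrightarrow>
     valid (Imp A J) \<and> valid (Imp J (Box \<alpha> J)) \<and> valid (Imp J S)"

text \<open>
  \<open>Post x\<close> is the variable \<open>x\<^sup>+\<close> belonging to the ordinary variable \<open>Cur x\<close>. Its freshness
  for a program or formula means that only ordinary variables occur there.
\<close>

datatype 'v var = Cur 'v | Post 'v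

definition upsilon :: "'v::linorder var hp \<Rightarrow> 'v var fml" where
  "upsilon \<alpha> =
     foldr And
       (map (\<lambda>x. Eq (Var (Post x)) (Var (Cur x))) (sorted_list_of_set {x. Cur x \<in> BV \<alpha>})) TT"

lemma sat_upsilon:
  "\<omega> \<Turnstile> upsilon \<alpha> \<longleftrightarrow> (\<forall>x. Cur x \<in> BV \<alpha> \<longrightarrow> \<omega> (Post x) = \<omega> (Cur x))"
proof -
  have "finite (Cur -` BV \<alpha>)"
    by (rule finite_vimageI[OF finite_BV]) (simp add: inj_on_def)
  then have fin: "finite {x. Cur x \<in> BV \<alpha>}"
    by (simp add: vimage_def)
  have "\<omega> \<Turnstile> foldr And (map (\<lambda>x. Eq (Var (Post x)) (Var (Cur x))) xs) TT \<longleftrightarrow>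
        (\<forall>x\<in>set xs. \<omega> (Post x) = \<omega> (Cur x))" for xs
    by (induction xs) auto
  with fin show ?thesis
    by (auto simp: upsilon_def)
qed

definition transition_sat :: "'v var state \<Rightarrow> 'v var state \<Rightarrow> 'v var fml \<Rightarrow> bool" where
  "transition_sat \<omega> \<nu> F \<longleftrightarrow>
     (\<lambda>y. case y of Cur x \<Rightarrow> \<omega> (Cur x) | Post x \<Rightarrow> \<nu> (Cur x)) \<Turnstile> F"

text \<open>
  The program \<open>ctrl; v := *; ?(u - \<Delta> \<le> v \<le> u + \<Delta>); {eqs & Q}\<close>, where \<open>v\<close> is the actual
  (disturbed) actuator effect of the control choice \<open>u\<close>.
\<close>

definition disturbance_nf ::
    "'a trm \<Rightarrow> 'a \<Rightarrow> 'a \<Rightarrow> 'a hp \<Rightarrow> ('a \<times> 'a trm) list \<Rightarrow> 'a fml \<Rightarrow> 'a hp" where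
  "disturbance_nf \<Delta> u v ctrl eqs Q =
     Seq ctrl
       (Seq (AssignAny v)
         (Seq (Test (And (Le (Minus (Var u) \<Delta>) (Var v)) (Le (Var v) (Plus (Var u) \<Delta>))))
           (ODE eqs Q)))"

end

theory Submission
  imports Defs
begin

text \<open>
  The monitor yields a run of \<open>\<alpha>\<close> from \<open>\<omega>\<close>, expanded by the post values \<open>\<nu>\<close>, to a state \<open>\<mu>\<close>
  satisfying \<open>J\<close>. Since \<open>\<alpha>\<close> leaves the variables \<open>x\<^sup>+\<close> alone, \<open>\<Upsilon>\<^sup>+\<close> says that \<open>\<mu>\<close> and \<open>\<nu>\<close> agree on
  the bound variables of \<open>\<alpha>\<close> other than the actuator effect, whose post value is quantified
  away; on the unbound variables they agree by the bound effect property. As \<open>J\<close> mentions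
  neither the actuator effect nor any \<open>x\<^sup>+\<close>, coincidence transfers \<open>J\<close> from \<open>\<mu>\<close> to \<open>\<nu>\<close>.
\<close>

section \<open>Occurring variables and the bound effect property\<close>

lemma BV_subset_vars: "BV \<alpha> \<subseteq> vars_hp \<alpha>"
  by (induction \<alpha> rule: hp.induct[where ?P1.0 = "\<lambda>_. True"])
    (auto 0 3 simp: fsts.simps)

lemma
  fixes F :: "'a fml" and \<alpha> :: "'a hp"
  shows FV_subset_vars: "FV F \<subseteq> vars_fml F"
    and FV_hp_subset_vars: "FV_hp \<alpha> \<subseteq> vars_hp \<alpha>"
  by (induction F and \<alpha>) (auto 0 3 simp: fsts.simps snds.simps)

text \<open>For differential equations this rests on the clause of \<open>ode_flow\<close> that
  keeps variables without an equation constant; the other programs compose or iterate single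
  writes.\<close>

lemma bound_effect:
  assumes "(\<omega>, \<nu>) \<in> hp_sem \<alpha>" "y \<notin> BV \<alpha>"
  shows "\<nu> y = \<omega> y"
  using assms
proof (induction \<alpha> arbitrary: \<omega> \<nu> rule: hp.induct[where ?P1.0 = "\<lambda>_. True"])
  case (ODE eqs Q)
  then obtain r \<phi> where "r \<ge> 0" "\<phi> 0 = \<omega>" "\<phi> r = \<nu>" and flow: "ode_flow eqs (fml_sem Q) r \<phi>"
    by auto
  moreover have "\<phi> r y = \<phi> 0 y"
  proof -
    have "r \<in> {0..r}" "y \<notin> fst ` set eqs"
      using \<open>r \<ge> 0\<close> ODE.prems(2) by simp_all
    then show ?thesis
      using flow unfolding ode_flow_def by blast
  qed
  ultimately show ?case
    by simp
next
  case (Loop \<alpha>)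
  have "(\<omega>, \<nu>) \<in> (hp_sem \<alpha>)\<^sup>*" "y \<notin> BV \<alpha>"
    using Loop.prems by auto
  then show ?case
    by (induction rule: rtrancl_induct) (auto dest: Loop.IH)
next
  case (Seq \<alpha> \<beta>)
  then obtain \<mu> where "(\<omega>, \<mu>) \<in> hp_sem \<alpha>" "(\<mu>, \<nu>) \<in> hp_sem \<beta>"
    by auto
  then show ?case
    using Seq.IH(1)[of \<omega> \<mu>] Seq.IH(2)[of \<mu> \<nu>] Seq.prems(2) by simp
next
  case (Choice \<alpha> \<beta>)
  then show ?case
    using Choice.IH(1)[of \<omega> \<nu>] Choice.IH(2)[of \<omega> \<nu>] by auto
qed auto

section \<open>Coincidence: truth and runs depend only on free variables\<close>

lemma trm_val_cong:
  assumes "\<And>x. x \<in> vars_trm \<theta> \<Longrightarrow> \<omega> x = \<omega>' x"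
  shows "trm_val \<theta> \<omega> = trm_val \<theta> \<omega>'"
  using assms by (induction \<theta>) auto

text \<open>Transplant the flow: variables with an equation follow \<phi>, all others are frozen at
  \<omega>'. The right-hand sides read only variables in \<open>V\<close>, where both flows agree,
  so the equations still hold.\<close>

lemma ode_flow_coincidence:
  assumes "r \<ge> 0"
    and flow: "ode_flow eqs R r \<phi>"
    and eqs: "fst ` set eqs \<union> (\<Union>(x, \<theta>)\<in>set eqs. vars_trm \<theta>) \<subseteq> V"
    and agree: "\<And>x. x \<in> V \<Longrightarrow> \<phi> 0 x = \<omega>' x"
    and R: "\<And>\<mu> \<mu>'. \<lbrakk>\<forall>x\<in>V. \<mu> x = \<mu>' x; \<mu> \<in> R\<rbrakk> \<Longrightarrow> \<mu>' \<in> R"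
  obtains \<phi>' where "\<phi>' 0 = \<omega>'" "ode_flow eqs R r \<phi>'" "\<And>x. x \<in> V \<Longrightarrow> \<phi> r x = \<phi>' r x"
proof -
  define \<phi>' where "\<phi>' = (\<lambda>t y. if y \<in> fst ` set eqs then \<phi> t y else \<omega>' y)"
  have const: "\<phi> t x = \<phi> 0 x" if "t \<in> {0..r}" "x \<notin> fst ` set eqs" for t x
    using flow that unfolding ode_flow_def by blast
  have same: "\<phi> t x = \<phi>' t x" if "t \<in> {0..r}" "x \<in> V" for t x
    using const[OF that(1), of x] agree[OF that(2)] by (simp add: \<phi>'_def)
  have start: "\<phi>' 0 = \<omega>'"
  proof
    fix y show "\<phi>' 0 y = \<omega>' y"
      using eqs agree[of y] unfolding \<phi>'_def by (simp add: subset_iff)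
  qed
  have flow': "ode_flow eqs R r \<phi>'"
    unfolding ode_flow_def
  proof (intro ballI conjI)
    fix t assume t: "t \<in> {0..r}"
    show "\<phi>' t \<in> R"
    proof (rule R)
      show "\<forall>x\<in>V. \<phi> t x = \<phi>' t x"
        using same t by simp
      show "\<phi> t \<in> R"
        using flow t unfolding ode_flow_def by simp
    qed
    show "case p of (x, \<theta>) \<Rightarrow>
        ((\<lambda>s. \<phi>' s x) has_real_derivative trm_val \<theta> (\<phi>' t)) (at t within {0..r})"
      if "p \<in> set eqs" for p
    proof -
      obtain x \<theta> where p: "p = (x, \<theta>)"
        by (cases p)
      have "((\<lambda>s. \<phi> s x) has_real_derivative trm_val \<theta> (\<phi> t)) (at t within {0..r})"
        using flow t that p unfolding ode_flow_def by fast
      moreover have "trm_val \<theta> (\<phi> t) = trm_val \<theta> (\<phi>' t)"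
        using eqs same[OF t] that p by (intro trm_val_cong) blast
      \<comment> \<open>The component of an equation variable is literally the same function of
        time, so its derivative carries over.\<close>
      moreover have "(\<lambda>s. \<phi>' s x) = (\<lambda>s. \<phi> s x)"
        using that p by (force simp: \<phi>'_def)
      ultimately show ?thesis
        using p by simp
    qed
    show "\<forall>y. y \<notin> fst ` set eqs \<longrightarrow> \<phi>' t y = \<phi>' 0 y"
      by (simp add: \<phi>'_def)
  qed
  show thesis
    using that[OF start flow'] same assms(1) by auto
qed

text \<open>Agreement on \<open>V\<close> is a simulation: each step is matched by a step that
  restores it, so whole runs are matched by induction on their length.\<close>

lemma rtrancl_coincidence:
  assumes "(\<omega>, \<nu>) \<in> R\<^sup>*" "\<forall>x\<in>V. \<omega> x = \<omega>' x"
    and step: "\<And>\<mu> \<nu> \<mu>'. \<lbrakk>(\<mu>, \<nu>) \<in> R; \<forall>x\<in>V. \<mu> x = \<mu>' x\<rbrakk>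
      \<Longrightarrow> \<exists>\<nu>'. (\<mu>', \<nu>') \<in> R \<and> (\<forall>x\<in>V. \<nu> x = \<nu>' x)"
  shows "\<exists>\<nu>'. (\<omega>', \<nu>') \<in> R\<^sup>* \<and> (\<forall>x\<in>V. \<nu> x = \<nu>' x)"
  using assms(1,2)
proof (induction rule: rtrancl_induct)
  case base
  then show ?case by blast
next
  case (step \<mu> \<nu>)
  then obtain \<mu>' where \<mu>': "(\<omega>', \<mu>') \<in> R\<^sup>*" "\<forall>x\<in>V. \<mu> x = \<mu>' x"
    by blast
  with assms(3)[OF step.hyps(2)] obtain \<nu>' where "(\<mu>', \<nu>') \<in> R" "\<forall>x\<in>V. \<nu> x = \<nu>' x"
    by blast
  then show ?case
    using \<mu>'(1) by (meson rtrancl.rtrancl_into_rtrancl)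
qed

text \<open>
  The agreement set \<open>V\<close> of the program part must be arbitrary: in \<open>[\<alpha>]F\<close> and \<open>\<alpha>; \<beta>\<close> it also has to
  carry the free variables of what comes after \<open>\<alpha>\<close>.
\<close>

lemma
  fixes F :: "'a fml" and \<alpha> :: "'a hp"
  shows coincidence_fml:
      "\<forall>x\<in>FV F. \<omega> x = \<omega>' x \<Longrightarrow> \<omega> \<Turnstile> F \<longleftrightarrow> \<omega>' \<Turnstile> F"
    and coincidence_hp:
      "\<lbrakk>(\<omega>, \<nu>) \<in> hp_sem \<alpha>; FV_hp \<alpha> \<subseteq> V; \<forall>x\<in>V. \<omega> x = \<omega>' x\<rbrakk>
        \<Longrightarrow> \<exists>\<nu>'. (\<omega>', \<nu>') \<in> hp_sem \<alpha> \<and> (\<forall>x\<in>V \<union> MBV \<alpha>. \<nu> x = \<nu>' x)"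
proof (induction F and \<alpha> arbitrary: \<omega> \<omega>' and \<omega> \<nu> \<omega>' V)
  case (Eq \<theta> \<eta>)
  then have "trm_val \<theta> \<omega> = trm_val \<theta> \<omega>'" "trm_val \<eta> \<omega> = trm_val \<eta> \<omega>'"
    by (auto intro: trm_val_cong)
  then show ?case by simp
next
  case (Le \<theta> \<eta>)
  then have "trm_val \<theta> \<omega> = trm_val \<theta> \<omega>'" "trm_val \<eta> \<omega> = trm_val \<eta> \<omega>'"
    by (auto intro: trm_val_cong)
  then show ?case by simp
next
  case (Lt \<theta> \<eta>)
  then have "trm_val \<theta> \<omega> = trm_val \<theta> \<omega>'" "trm_val \<eta> \<omega> = trm_val \<eta> \<omega>'"
    by (auto intro: trm_val_cong)
  then show ?case by simp
next
  case (Not F)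
  then have "\<omega> \<Turnstile> F \<longleftrightarrow> \<omega>' \<Turnstile> F"
    by (intro Not.IH) simp
  then show ?case by simp
next
  case (And F G)
  have "\<omega> \<Turnstile> F \<longleftrightarrow> \<omega>' \<Turnstile> F" "\<omega> \<Turnstile> G \<longleftrightarrow> \<omega>' \<Turnstile> G"
    using And.prems by (auto intro!: And.IH)
  then show ?case by simp
next
  case (Or F G)
  have "\<omega> \<Turnstile> F \<longleftrightarrow> \<omega>' \<Turnstile> F" "\<omega> \<Turnstile> G \<longleftrightarrow> \<omega>' \<Turnstile> G"
    using Or.prems by (auto intro!: Or.IH)
  then show ?case by simp
next
  case (Imp F G)
  have "\<omega> \<Turnstile> F \<longleftrightarrow> \<omega>' \<Turnstile> F" "\<omega> \<Turnstile> G \<longleftrightarrow> \<omega>' \<Turnstile> G"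
    using Imp.prems by (auto intro!: Imp.IH)
  then show ?case by simp
next
  case (Iff F G)
  have "\<omega> \<Turnstile> F \<longleftrightarrow> \<omega>' \<Turnstile> F" "\<omega> \<Turnstile> G \<longleftrightarrow> \<omega>' \<Turnstile> G"
    using Iff.prems by (auto intro!: Iff.IH)
  then show ?case by simp
next
  case (All x F)
  have "\<omega>(x := d) \<Turnstile> F \<longleftrightarrow> \<omega>'(x := d) \<Turnstile> F" for d
    using All.prems by (intro All.IH) auto
  then show ?case by simp
next
  case (Ex x F)
  have "\<omega>(x := d) \<Turnstile> F \<longleftrightarrow> \<omega>'(x := d) \<Turnstile> F" for d
    using Ex.prems by (intro Ex.IH) auto
  then show ?case by simp
next
  case (Box \<alpha> F)
  \<comment> \<open>Stated for arbitrary start states because the equivalence needs it in both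
    directions. The agreement set is the free variables of the whole modality; together with
    \<open>MBV \<alpha>\<close> it covers \<open>FV F\<close>.\<close>
  have transfer: "\<exists>\<nu>'. (\<mu>', \<nu>') \<in> hp_sem \<alpha> \<and> (\<nu> \<Turnstile> F \<longleftrightarrow> \<nu>' \<Turnstile> F)"
    if run: "(\<mu>, \<nu>) \<in> hp_sem \<alpha>" and agree: "\<forall>x\<in>FV (Box \<alpha> F). \<mu> x = \<mu>' x" for \<mu> \<mu>' \<nu>
  proof -
    obtain \<nu>' where \<nu>': "(\<mu>', \<nu>') \<in> hp_sem \<alpha>" "\<forall>x\<in>FV (Box \<alpha> F) \<union> MBV \<alpha>. \<nu> x = \<nu>' x"
      using Box.IH(1)[OF run _ agree] by auto
    then have "\<nu> \<Turnstile> F \<longleftrightarrow> \<nu>' \<Turnstile> F"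
      by (intro Box.IH(2)) auto
    with \<nu>' show ?thesis by blast
  qed
  show ?case
    using transfer[of \<omega> _ \<omega>'] transfer[of \<omega>' _ \<omega>] Box.prems
    by (simp only: fml_sem.simps mem_Collect_eq) metis
next
  case (Dia \<alpha> F)
  have transfer: "\<exists>\<nu>'. (\<mu>', \<nu>') \<in> hp_sem \<alpha> \<and> (\<nu> \<Turnstile> F \<longleftrightarrow> \<nu>' \<Turnstile> F)"
    if run: "(\<mu>, \<nu>) \<in> hp_sem \<alpha>" and agree: "\<forall>x\<in>FV (Dia \<alpha> F). \<mu> x = \<mu>' x" for \<mu> \<mu>' \<nu>
  proof -
    obtain \<nu>' where \<nu>': "(\<mu>', \<nu>') \<in> hp_sem \<alpha>" "\<forall>x\<in>FV (Dia \<alpha> F) \<union> MBV \<alpha>. \<nu> x = \<nu>' x"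
      using Dia.IH(1)[OF run _ agree] by auto
    then have "\<nu> \<Turnstile> F \<longleftrightarrow> \<nu>' \<Turnstile> F"
      by (intro Dia.IH(2)) auto
    with \<nu>' show ?thesis by blast
  qed
  show ?case
    using transfer[of \<omega> _ \<omega>'] transfer[of \<omega>' _ \<omega>] Dia.prems
    by (simp only: fml_sem.simps mem_Collect_eq) metis
next
  case (Assign x \<theta>)
  moreover have "trm_val \<theta> \<omega> = trm_val \<theta> \<omega>'"
    using Assign.prems by (intro trm_val_cong) auto
  ultimately show ?case by simp
next
  case (AssignAny x)
  then obtain d where "\<nu> = \<omega>(x := d)" by auto
  then show ?case
    using AssignAny.prems(3) by (intro exI[of _ "\<omega>'(x := d)"]) fastforce
next
  case (Test F)
  have "\<omega> \<Turnstile> F \<longleftrightarrow> \<omega>' \<Turnstile> F"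
    using Test.prems by (intro Test.IH) auto
  then show ?case
    using Test.prems by auto
next
  case (ODE eqs Q)
  obtain r \<phi> where r: "r \<ge> 0" "\<phi> 0 = \<omega>" "\<phi> r = \<nu>" and flow: "ode_flow eqs (fml_sem Q) r \<phi>"
    using ODE.prems(1) by auto
  have "\<mu>' \<Turnstile> Q" if "\<forall>x\<in>V. \<mu> x = \<mu>' x" "\<mu> \<Turnstile> Q" for \<mu> \<mu>'
  proof -
    have "\<forall>x\<in>FV Q. \<mu> x = \<mu>' x"
      using that(1) ODE.prems(2) by auto
    then show ?thesis
      using ODE.IH that(2) by blast
  qed
  then obtain \<phi>' where \<phi>': "\<phi>' 0 = \<omega>'" "ode_flow eqs (fml_sem Q) r \<phi>'"
      "\<And>x. x \<in> V \<Longrightarrow> \<phi> r x = \<phi>' r x"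
    using ode_flow_coincidence[OF r(1) flow, of V \<omega>'] ODE.prems(2,3) r(2) by auto
  have "(\<omega>', \<phi>' r) \<in> hp_sem (ODE eqs Q)"
    using r(1) \<phi>'(1,2) by auto
  \<comment> \<open>\<open>MBV\<close> adds nothing here: the equation variables are already free,
    as their final values depend on the initial ones, and hence lie in \<open>V\<close>.\<close>
  moreover have "\<forall>x\<in>V \<union> MBV (ODE eqs Q). \<nu> x = \<phi>' r x"
    using \<phi>'(3) r(3) ODE.prems(2) by auto
  ultimately show ?case by blast
next
  case (Seq \<alpha> \<beta>)
  obtain \<mu> where \<mu>: "(\<omega>, \<mu>) \<in> hp_sem \<alpha>" "(\<mu>, \<nu>) \<in> hp_sem \<beta>"
    using Seq.prems(1) by auto
  obtain \<mu>' where \<mu>': "(\<omega>', \<mu>') \<in> hp_sem \<alpha>" "\<forall>x\<in>V \<union> MBV \<alpha>. \<mu> x = \<mu>' x"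
    using Seq.IH(1)[OF \<mu>(1) _ Seq.prems(3)] Seq.prems(2) by auto
  \<comment> \<open>After \<alpha> the agreement set has grown by \<open>MBV \<alpha>\<close>, which
    are exactly the variables that \<open>FV_hp\<close> of the composition may drop from
    \<beta>.\<close>
  have "FV_hp \<beta> \<subseteq> V \<union> MBV \<alpha>"
    using Seq.prems(2) by auto
  from Seq.IH(2)[OF \<mu>(2) this \<mu>'(2)] obtain \<nu>'
    where "(\<mu>', \<nu>') \<in> hp_sem \<beta>" "\<forall>x\<in>(V \<union> MBV \<alpha>) \<union> MBV \<beta>. \<nu> x = \<nu>' x"
    by blast
  with \<mu>'(1) show ?case by auto
next
  case (Choice \<alpha> \<beta>)
  from Choice.prems(1) consider "(\<omega>, \<nu>) \<in> hp_sem \<alpha>" | "(\<omega>, \<nu>) \<in> hp_sem \<beta>"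
    by auto
  then show ?case
  proof cases
    case 1
    \<comment> \<open>Either branch suffices, since \<open>MBV\<close> of a choice is contained in
      that of each branch.\<close>
    from Choice.IH(1)[OF this _ Choice.prems(3)] Choice.prems(2) show ?thesis by auto
  next
    case 2
    from Choice.IH(2)[OF this _ Choice.prems(3)] Choice.prems(2) show ?thesis by auto
  qed
next
  case (Loop \<alpha>)
  \<comment> \<open>A loop may run zero times and so has empty \<open>MBV\<close>; only agreement on
    \<open>V\<close> is carried through the iterations.\<close>
  have "\<exists>\<nu>'. (\<mu>', \<nu>') \<in> hp_sem \<alpha> \<and> (\<forall>x\<in>V. \<nu> x = \<nu>' x)"
    if "(\<mu>, \<nu>) \<in> hp_sem \<alpha>" "\<forall>x\<in>V. \<mu> x = \<mu>' x" for \<mu> \<nu> \<mu>'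
    using Loop.IH[OF that(1) _ that(2)] Loop.prems(2) by auto
  then show ?case
    using rtrancl_coincidence[of \<omega> \<nu> "hp_sem \<alpha>" V \<omega>'] Loop.prems by auto
qed simp

section \<open>From the monitor to the invariant in the observed state\<close>

theorem theorem3:
  fixes \<alpha> ctrl :: "'v::linorder var hp"
    and eqs :: "('v var \<times> 'v var trm) list"
    and A J S Q :: "'v var fml"
    and \<Delta> :: "'v var trm"
    and u v :: 'v
    and \<omega> \<nu> :: "'v var state"
  assumes normal_form: "\<alpha> = disturbance_nf \<Delta> (Cur u) (Cur v) ctrl eqs Q"
    and Delta_nonneg: "\<omega> \<Turnstile> Le (Const 0) \<Delta>"
    and fresh: "vars_hp \<alpha> \<union> vars_fml J \<subseteq> range Cur"
    and invariant: "inductive_invariant A \<alpha> S J"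
    and not_free: "Cur v \<notin> FV J"
    and agree: "\<forall>x. x \<notin> BV \<alpha> \<longrightarrow> \<omega> x = \<nu> x"
    and init: "\<omega> \<Turnstile> J"
    and monitor: "transition_sat \<omega> \<nu> (Dia \<alpha> (Ex (Post v) (upsilon \<alpha>)))"
  shows "\<nu> \<Turnstile> J"
proof -
  \<comment> \<open>This is the state in which \<open>transition_sat\<close> evaluates the monitor,
    and hence where the run starts.\<close>
  define \<omega>' where "\<omega>' = (\<lambda>y. case y of Cur x \<Rightarrow> \<omega> (Cur x) | Post x \<Rightarrow> \<nu> (Cur x))"
  have \<omega>'_simps: "\<omega>' (Cur x) = \<omega> (Cur x)" "\<omega>' (Post x) = \<nu> (Cur x)" for x
    by (simp_all add: \<omega>'_def)
  have FV_J: "FV J \<subseteq> range Cur"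
    using fresh FV_subset_vars[of J] by blast
  have Post_unbound: "Post x \<notin> BV \<alpha>" for x
    using fresh BV_subset_vars[of \<alpha>] by blast
  obtain \<mu> d where run: "(\<omega>', \<mu>) \<in> hp_sem \<alpha>" and ups: "\<mu>(Post v := d) \<Turnstile> upsilon \<alpha>"
    using monitor unfolding transition_sat_def \<omega>'_def[symmetric] by auto
  have "\<omega>' \<Turnstile> J"
  proof -
    have "\<forall>y\<in>FV J. \<omega> y = \<omega>' y"
      using FV_J by (auto simp: \<omega>'_simps)
    with init show ?thesis
      using coincidence_fml by blast
  qed
  then have "\<mu> \<Turnstile> J"
    using invariant run unfolding inductive_invariant_def valid_def by auto
  moreover have "\<mu> (Cur x) = \<nu> (Cur x)" if "x \<noteq> v" for x
  proof (cases "Cur x \<in> BV \<alpha>")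
    case True
    then have "\<mu> (Cur x) = \<mu> (Post x)"
      \<comment> \<open>The update by \<open>d\<close> touches only \<open>Post v\<close>, so for
        \<open>x\<close> other than \<open>v\<close> the equation speaks about \<mu> itself.\<close>
      using ups that by (auto simp: sat_upsilon)
    also have "\<dots> = \<nu> (Cur x)"
      \<comment> \<open>\<open>Post x\<close> still holds the value from \<omega>', which is the
        observed \<nu> value.\<close>
      using bound_effect[OF run Post_unbound] by (simp add: \<omega>'_simps)
    finally show ?thesis .
  next
    case False
    then show ?thesis
      using bound_effect[OF run False] agree by (simp add: \<omega>'_simps)
  qed
  then have "\<forall>y\<in>FV J. \<mu> y = \<nu> y"
    using FV_J not_free by (metis imageE subsetD)
  ultimately show ?thesis
    using coincidence_fml by blast
qed

end
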